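(* Let $G$ be a connected cubic graph on $n\geq 6$ vertices that contains a triangle-factor. If $n=6$, then the graph $G$ is $\mathcal{D}$. Otherwise (i.e. if $n>6$), the graph $G$ is $\mathcal{S}$.
   Context: Graphs are finite and simple; a cubic graph is a $3$-regular graph. The Maker--Breaker total domination (MBTD) game on a graph $G$: two players, Dominator and Staller, alternately claim one previously unclaimed vertex of $G$ per move. Staller wins if at some point she has claimed all vertices of the open neighbourhood $N_G(v)$ of some vertex $v$ of $G$; otherwise Dominator wins. A graph is $\mathcal{D}$ if Dominator has a winning strategy regardless of who moves first, and it is $\mathcal{S}$ if Staller has a winning strategy regardless of who moves first. A diamond is the complete graph on four vertices minus one edge. A triangle means an induced $K_3$ which is not part of a diamond. A graph on $n$ vertices contains a triangle-factor if $n$ is divisible by $3$ and the graph contains $n/3$ vertex-disjoint triangles. *)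

theory Defs
  imports "Graph_Theory.Graph_Theory"
begin

text \<open>
  A finite simple graph is a \<open>G\<close> satisfying the locale predicate \<open>graph\<close>: a finite loopfree
  symmetric digraph without parallel arcs. Each undirected edge is thus a pair of opposite arcs,
  and the degree of a vertex is its out-degree.
\<close>

definition cubic :: "('a, 'b) pre_digraph \<Rightarrow> bool" where
  "cubic G \<longleftrightarrow> (\<forall>v \<in> verts G. out_degree G v = 3)"

definition open_nbhd :: "('a, 'b) pre_digraph \<Rightarrow> 'a \<Rightarrow> 'a set" where
  "open_nbhd G v = {u. v \<rightarrow>\<^bsub>G\<^esub> u}"


section \<open>Triangles and triangle-factors\<close>

definition diamond :: "('a, 'b) pre_digraph \<Rightarrow> bool" where
  "diamond H \<longleftrightarrow> graph H \<and> card (verts H) = 4 \<and>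
     (\<exists>x \<in> verts H. \<exists>y \<in> verts H. x \<noteq> y \<and>
        arcs_ends H = {(u, v). u \<in> verts H \<and> v \<in> verts H \<and> u \<noteq> v} - {(x, y), (y, x)})"

text \<open>
  Diamonds are taken as not necessarily induced subgraphs. This matters only for a \<open>K\<^sub>4\<close>, which
  does not occur in a connected cubic graph on more than four vertices.
\<close>

definition triangle :: "('a, 'b) pre_digraph \<Rightarrow> 'a set \<Rightarrow> bool" where
  "triangle G T \<longleftrightarrow> T \<subseteq> verts G \<and> K\<^bsub>3\<^esub> (G \<restriction> T) \<and>
     \<not> (\<exists>H. subgraph H G \<and> diamond H \<and> T \<subseteq> verts H)"

definition has_triangle_factor :: "('a, 'b) pre_digraph \<Rightarrow> bool" where
  "has_triangle_factor G \<longleftrightarrow> 3 dvd card (verts G) \<and>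
     (\<exists>F. finite F \<and> card F = card (verts G) div 3 \<and> (\<forall>T \<in> F. triangle G T) \<and> pairwise disjnt F)"


section \<open>The Maker--Breaker total domination game\<close>

datatype player = Dominator | Staller

fun opponent :: "player \<Rightarrow> player" where
  "opponent Dominator = Staller"
| "opponent Staller = Dominator"

text \<open>
  A play is recorded as the list of claimed vertices in the order in which they are claimed;
  \<open>turn f i\<close> is the player making move \<open>i\<close> (counted from 0) when \<open>f\<close> moves first.
\<close>

definition turn :: "player \<Rightarrow> nat \<Rightarrow> player" where
  "turn f i = (if even i then f else opponent f)"

definition claimed :: "player \<Rightarrow> 'a list \<Rightarrow> player \<Rightarrow> 'a set" where
  "claimed f p P = {p ! i | i. i < length p \<and> turn f i = P}"

text \<open>
  Plays are continued until every vertex is claimed; moves made after Staller has already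
  claimed a full open neighbourhood do not change the outcome.
\<close>

definition complete_play :: "('a, 'b) pre_digraph \<Rightarrow> 'a list \<Rightarrow> bool" where
  "complete_play G p \<longleftrightarrow> distinct p \<and> set p = verts G"

definition staller_wins :: "('a, 'b) pre_digraph \<Rightarrow> player \<Rightarrow> 'a list \<Rightarrow> bool" where
  "staller_wins G f p \<longleftrightarrow>
     (\<exists>k \<le> length p. \<exists>v \<in> verts G. open_nbhd G v \<subseteq> claimed f (take k p) Staller)"

fun wins :: "player \<Rightarrow> ('a, 'b) pre_digraph \<Rightarrow> player \<Rightarrow> 'a list \<Rightarrow> bool" where
  "wins Staller G f p \<longleftrightarrow> staller_wins G f p"
| "wins Dominator G f p \<longleftrightarrow> \<not> staller_wins G f p"

text \<open>
  A strategy maps the history of moves to the next vertex. It must prescribe a legal move at every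
  unfinished history at which its player is to move; otherwise it could win vacuously.
\<close>

definition strategy :: "('a, 'b) pre_digraph \<Rightarrow> player \<Rightarrow> player \<Rightarrow> ('a list \<Rightarrow> 'a) \<Rightarrow> bool" where
  "strategy G f P \<sigma> \<longleftrightarrow>
     (\<forall>h. distinct h \<and> set h \<subset> verts G \<and> turn f (length h) = P \<longrightarrow> \<sigma> h \<in> verts G - set h)"

definition follows :: "player \<Rightarrow> player \<Rightarrow> ('a list \<Rightarrow> 'a) \<Rightarrow> 'a list \<Rightarrow> bool" where
  "follows f P \<sigma> p \<longleftrightarrow> (\<forall>i < length p. turn f i = P \<longrightarrow> p ! i = \<sigma> (take i p))"

definition has_winning_strategy :: "('a, 'b) pre_digraph \<Rightarrow> player \<Rightarrow> player \<Rightarrow> bool" where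
  "has_winning_strategy G f P \<longleftrightarrow>
     (\<exists>\<sigma>. strategy G f P \<sigma> \<and> (\<forall>p. complete_play G p \<and> follows f P \<sigma> p \<longrightarrow> wins P G f p))"

definition graph_D :: "('a, 'b) pre_digraph \<Rightarrow> bool" where
  "graph_D G \<longleftrightarrow> (\<forall>f. has_winning_strategy G f Dominator)"

definition graph_S :: "('a, 'b) pre_digraph \<Rightarrow> bool" where
  "graph_S G \<longleftrightarrow> (\<forall>f. has_winning_strategy G f Staller)"

end

theory Submission
  imports Defs
begin

text \<open>
  Contract every triangle of the factor to a point. The three edges leaving a triangle belong to
  its three different vertices, so the result is a cubic multigraph \<open>M\<close> without loops, and a vertex
  \<open>x\<close> of \<open>G\<close> is a dart of \<open>M\<close>: the end of one edge, whose other end is the vertex \<open>mate x\<close>. In a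
  triangle \<open>{x, y, z}\<close> the open neighbourhood of \<open>x\<close> is \<open>{mate x, y, z}\<close>. The locale
  \<open>triangle_tiling\<close> keeps exactly this much of \<open>G\<close>, and \<open>cubic_triangle_tiling\<close> extracts it.

  Since \<open>mate\<close> has no fixed points, the number of triangles is even; so it is 2 if \<open>G\<close> has six
  vertices, and at least 4 if \<open>G\<close> has more.

  With two triangles \<open>G\<close> is the prism. There a vertex \<open>v\<close> lies in three open neighbourhoods and the
  other three all contain \<open>mate v\<close>. Dominator therefore starts with a suitable \<open>v\<close> and wants
  \<open>mate v\<close> next; if Staller takes it first, two neighbourhoods are met by one further vertex, and the
  last one still has two free vertices, of which Dominator gets one (\<open>prism_Dominator\<close>).

  With at least four triangles Staller wins even if Dominator has already claimed some vertex \<open>u\<close>.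
  Deleting the triangle of \<open>u\<close> from \<open>M\<close> leaves at least as many edges as points, hence a cycle, and
  connectedness lets it be chosen induced (\<open>induced_cycle\<close>): a nonempty set \<open>X\<close> of triangles, each
  having exactly two vertices whose mates are in triangles of \<open>X\<close>. Staller can follow such a
  cycle with threats only: if she owns \<open>s\<close> and
  \<open>{mate s, p, q}\<close> is the next triangle, with \<open>p\<close> leading on along the cycle, then claiming \<open>p\<close>
  threatens \<open>q\<close> by the neighbourhood of \<open>mate s\<close>, so Dominator has to take \<open>q\<close>, and Staller goes on
  from \<open>p\<close> (\<open>walk_along_cycle\<close>). She starts with a vertex \<open>a\<close> of some triangle \<open>{a, b, c}\<close> of the
  cycle, where \<open>c\<close> is the vertex off the cycle. Whatever Dominator answers, either the walk comes back
  through \<open>b\<close> and makes a double threat there, or a double threat arises next to \<open>{a, b, c}\<close>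
  (\<open>cycle_wins\<close>). Such a triangle can be chosen with \<open>mate c\<close> different from \<open>u\<close>, as different
  triangles have different vertices \<open>c\<close>.
\<close>

section \<open>Winning as a property of positions\<close>

text \<open>
  Plays are abstracted to pairs \<open>A\<close>, \<open>C\<close> of the sets claimed by one distinguished player and by the
  opponent. The distinguished player wants the own set to satisfy the monotone property \<open>g\<close>. The
  relation \<open>forces\<close> describes the won positions with this player to move, \<open>awaits\<close> those with the
  opponent to move. Both players' goals have this form, and the board is finite, so a
  least fixed point suffices for both. The condition \<open>V - A - C \<noteq> {}\<close> in \<open>awaits_move\<close> keeps a full
  board on which \<open>g\<close> fails from counting as won.
\<close>

inductive forces :: "'a set \<Rightarrow> ('a set \<Rightarrow> bool) \<Rightarrow> 'a set \<Rightarrow> 'a set \<Rightarrow> bool"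
  and awaits :: "'a set \<Rightarrow> ('a set \<Rightarrow> bool) \<Rightarrow> 'a set \<Rightarrow> 'a set \<Rightarrow> bool"
  for V :: "'a set" and g :: "'a set \<Rightarrow> bool" where
  forces_done: "g A \<Longrightarrow> forces V g A C"
| forces_move: "x \<in> V - A - C \<Longrightarrow> awaits V g (insert x A) C \<Longrightarrow> forces V g A C"
| awaits_done: "g A \<Longrightarrow> awaits V g A C"
| awaits_move: "V - A - C \<noteq> {} \<Longrightarrow> (\<And>y. y \<in> V - A - C \<Longrightarrow> forces V g A (insert y C)) \<Longrightarrow> awaits V g A C"

lemma claimed_Nil [simp]: "claimed f [] P = {}"
  by (simp add: claimed_def)

lemma claimed_image: "claimed f p P = (!) p ` {i. i < length p \<and> turn f i = P}"
  by (auto simp: claimed_def)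

lemma claimed_snoc:
  "claimed f (p @ [x]) P = (if turn f (length p) = P then insert x (claimed f p P) else claimed f p P)"
proof -
  have "(!) (p @ [x]) ` {i. i < length p \<and> turn f i = P} = claimed f p P"
    unfolding claimed_image by (rule image_cong) (auto simp: nth_append)
  moreover have "{i. i < length (p @ [x]) \<and> turn f i = P} =
      {i. i < length p \<and> turn f i = P} \<union> (if turn f (length p) = P then {length p} else {})"
    by (auto simp: less_Suc_eq)
  ultimately show ?thesis unfolding claimed_image[of f "p @ [x]"] by (simp add: image_Un)
qed

lemma opponent_cases: "Q = P \<or> Q = opponent P"
  by (cases P; cases Q) auto

lemma opponent_neq [simp]: "opponent P \<noteq> P" "P \<noteq> opponent P"
  by (cases P; simp)+

lemma opponent_opponent [simp]: "opponent (opponent P) = P"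
  by (cases P) simp_all

lemma turn_Suc: "turn f (Suc i) = opponent (turn f i)"
  by (cases f) (auto simp: turn_def)

lemma claimed_Un: "claimed f p P \<union> claimed f p (opponent P) = set p"
proof -
  have "{i. i < length p \<and> turn f i = P} \<union> {i. i < length p \<and> turn f i = opponent P} = {..<length p}"
    using opponent_cases[of _ P] by blast
  then have "claimed f p P \<union> claimed f p (opponent P) = (!) p ` {..<length p}"
    unfolding claimed_image image_Un[symmetric] by simp
  then show ?thesis by (auto simp: set_conv_nth)
qed

lemma claimed_disjoint:
  assumes "distinct p"
  shows "claimed f p P \<inter> claimed f p (opponent P) = {}"
proof (rule ccontr)
  assume "claimed f p P \<inter> claimed f p (opponent P) \<noteq> {}"
  then obtain i j where "i < length p" "j < length p" "p ! i = p ! j"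
    and t: "turn f i = P" "turn f j = opponent P"
    unfolding claimed_def by blast
  then have "i = j" using assms nth_eq_iff_index_eq by blast
  with t show False by simp
qed

text \<open>
  The strategy looks only at the two claimed sets and keeps the position among the won ones. On the
  full board no rule but the two stopping rules can apply, so the goal has been reached by then. The
  goal being monotone is what allows play to go on after it has been reached.
\<close>

lemma winning_strategyI:
  fixes G :: "('a, 'b) pre_digraph"
  assumes mono: "\<And>A A'. A \<subseteq> A' \<Longrightarrow> g A \<Longrightarrow> g A'"
    and start: "if f = P then forces (verts G) g {} {} else awaits (verts G) g {} {}"
    and goal: "\<And>p. complete_play G p \<Longrightarrow> g (claimed f p P) \<Longrightarrow> wins P G f p"
  shows "has_winning_strategy G f P"
proof -
  let ?V = "verts G"
  define A where "A h = claimed f h P" for h :: "'a list"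
  define C where "C h = claimed f h (opponent P)" for h :: "'a list"
  define good where
    "good h x \<longleftrightarrow> x \<in> ?V - set h \<and> (forces ?V g (A h) (C h) \<longrightarrow> awaits ?V g (insert x (A h)) (C h))" for h x
  define \<sigma> where "\<sigma> h = (SOME x. good h x)" for h
  have AC: "A h \<union> C h = set h" for h
    unfolding A_def C_def by (rule claimed_Un)
  have good: "good h (\<sigma> h)" if sub: "set h \<subset> ?V" for h
  proof -
    obtain x where x: "x \<in> ?V - set h" using sub by blast
    have "\<exists>x. good h x"
    proof (cases "forces ?V g (A h) (C h)")
      case True
      then show ?thesis
      proof cases
        case forces_done
        then have "awaits ?V g (insert x (A h)) (C h)"
          by (meson awaits_done mono subset_insertI)
        then have "good h x" using x by (simp add: good_def)
        then show ?thesis by blast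
      next
        case (forces_move y)
        then have "good h y" using AC[of h] by (auto simp: good_def)
        then show ?thesis by blast
      qed
    next
      case False
      then have "good h x" using x by (simp add: good_def)
      then show ?thesis by blast
    qed
    then show ?thesis unfolding \<sigma>_def by (rule someI_ex)
  qed
  have strat: "strategy G f P \<sigma>"
    unfolding strategy_def using good by (simp add: good_def)
  have "wins P G f p" if p: "complete_play G p" and fol: "follows f P \<sigma> p" for p
  proof -
    have dp: "distinct p" and sp: "set p = ?V" using p by (auto simp: complete_play_def)
    have inv: "if turn f i = P then forces ?V g (A (take i p)) (C (take i p))
               else awaits ?V g (A (take i p)) (C (take i p))" if "i \<le> length p" for i
      using that
    proof (induction i)
      case 0
      then show ?case using start by (simp add: A_def C_def turn_def)
    next
      case (Suc i)
      let ?h = "take i p"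
      have il: "i < length p" and len: "min (length p) i = i" using Suc.prems by auto
      have tk: "take (Suc i) p = ?h @ [p ! i]" using il by (simp add: take_Suc_conv_app_nth)
      have free: "p ! i \<in> ?V - set ?h"
      proof -
        have "distinct (?h @ p ! i # drop (Suc i) p)" using dp id_take_nth_drop[OF il] by simp
        then show ?thesis using sp il nth_mem[OF il] by simp
      qed
      then have sub: "set ?h \<subset> ?V" using sp set_take_subset[of i p] by blast
      show ?case
      proof (cases "turn f i = P")
        case True
        then have "p ! i = \<sigma> ?h" using fol il by (simp add: follows_def)
        then have "awaits ?V g (insert (p ! i) (A ?h)) (C ?h)"
          using good[OF sub] Suc True by (simp add: good_def)
        then show ?thesis using True by (simp add: tk A_def C_def claimed_snoc turn_Suc len)
      next
        case False
        then have opp: "turn f i = opponent P" using opponent_cases by blast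
        have "awaits ?V g (A ?h) (C ?h)" using Suc False by simp
        then have "forces ?V g (A ?h) (insert (p ! i) (C ?h))"
        proof cases
          case awaits_done
          then show ?thesis by (rule forces_done)
        next
          case awaits_move
          then show ?thesis using free AC[of ?h] by blast
        qed
        then show ?thesis using opp by (simp add: tk A_def C_def claimed_snoc turn_Suc len)
      qed
    qed
    have full: "?V - A p - C p = {}" using AC[of p] sp by blast
    have "g (A p)"
    proof (cases "turn f (length p) = P")
      case True
      then have "forces ?V g (A p) (C p)" using inv[of "length p"] by simp
      then show ?thesis by cases (use full in auto)
    next
      case False
      then have "awaits ?V g (A p) (C p)" using inv[of "length p"] by simp
      then show ?thesis by cases (use full in auto)
    qed
    then show ?thesis using goal[OF p] by (simp add: A_def)
  qed
  then show ?thesis unfolding has_winning_strategy_def using strat by blast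
qed

section \<open>The two goals, forced replies and double threats\<close>

definition encloses :: "'a set \<Rightarrow> ('a \<Rightarrow> 'a set) \<Rightarrow> 'a set \<Rightarrow> bool" where
  "encloses V N A \<longleftrightarrow> (\<exists>v \<in> V. N v \<subseteq> A)"

text \<open>
  For Dominator, preventing Staller from claiming an open neighbourhood is the same, on the full board,
  as meeting all of them; in this form Dominator's task is also a monotone goal on the own set.
\<close>

definition meets_all :: "'a set \<Rightarrow> ('a \<Rightarrow> 'a set) \<Rightarrow> 'a set \<Rightarrow> bool" where
  "meets_all V N A \<longleftrightarrow> (\<forall>v \<in> V. N v \<inter> A \<noteq> {})"

lemma Staller_strategyI:
  assumes "if f = Staller then forces (verts G) (encloses (verts G) (open_nbhd G)) {} {}
           else awaits (verts G) (encloses (verts G) (open_nbhd G)) {} {}"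
  shows "has_winning_strategy G f Staller"
proof (rule winning_strategyI[OF _ assms])
  fix p assume "encloses (verts G) (open_nbhd G) (claimed f p Staller)"
  then show "wins Staller G f p"
    unfolding encloses_def wins.simps staller_wins_def by (intro exI[of _ "length p"]) simp
qed (auto simp: encloses_def)

lemma Dominator_strategyI:
  assumes "if f = Dominator then forces (verts G) (meets_all (verts G) (open_nbhd G)) {} {}
           else awaits (verts G) (meets_all (verts G) (open_nbhd G)) {} {}"
  shows "has_winning_strategy G f Dominator"
proof (rule winning_strategyI[OF _ assms])
  fix p assume p: "complete_play G p" and hit: "meets_all (verts G) (open_nbhd G) (claimed f p Dominator)"
  have "claimed f (take k p) Staller \<subseteq> claimed f p Staller" for k
    by (auto simp: claimed_def)
  moreover have "claimed f p Dominator \<inter> claimed f p Staller = {}"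
    using claimed_disjoint[of p f Dominator] p by (simp add: complete_play_def)
  ultimately show "wins Dominator G f p"
    using hit unfolding meets_all_def wins.simps staller_wins_def by blast
qed (auto simp: meets_all_def)

text \<open>
  Having claimed \<open>x\<close>, Staller lacks only \<open>y\<close> in \<open>N v\<close>; unless Dominator answers \<open>y\<close>, she takes it and
  has won. So the exchange of \<open>x\<close> for \<open>y\<close> can be played at no cost.
\<close>

lemma forced_reply:
  assumes "v \<in> V" "N v \<subseteq> insert x (insert y S)" "x \<in> V - S - D" "y \<in> V - S - D" "x \<noteq> y"
    and next_move: "forces V (encloses V N) (insert x S) (insert y D)"
  shows "forces V (encloses V N) S D"
proof (rule forces_move[OF assms(3)], rule awaits_move)
  show "V - insert x S - D \<noteq> {}" using assms by blast
  fix w assume w: "w \<in> V - insert x S - D"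
  show "forces V (encloses V N) (insert x S) (insert w D)"
  proof (cases "w = y")
    case False
    have "encloses V N (insert y (insert x S))" using assms(1,2) by (auto simp: encloses_def)
    then show ?thesis
      by (intro forces_move[of y] awaits_done) (use assms False in auto)
  qed (use next_move in simp)
qed

lemma double_threat:
  assumes "x \<in> V - S - D" "y \<in> V - S - D" "z \<in> V - S - D" "x \<noteq> y" "x \<noteq> z" "y \<noteq> z"
    and "v \<in> V" "N v \<subseteq> insert x (insert y S)"
    and "w \<in> V" "N w \<subseteq> insert x (insert z S)"
  shows "forces V (encloses V N) S D"
proof (rule forced_reply[of v])
  have "encloses V N (insert z (insert x S))" using assms by (auto simp: encloses_def)
  then show "forces V (encloses V N) (insert x S) (insert y D)"
    by (intro forces_move[of z] awaits_done) (use assms in auto)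
qed (use assms in auto)

section \<open>Vertex sets tiled by triangles\<close>

lemma even_card_involution:
  assumes "finite A" "\<And>x. x \<in> A \<Longrightarrow> h x \<in> A" "\<And>x. x \<in> A \<Longrightarrow> h (h x) = x" "\<And>x. x \<in> A \<Longrightarrow> h x \<noteq> x"
  shows "even (card A)"
  using assms
proof (induction "card A" arbitrary: A rule: less_induct)
  case less
  show ?case
  proof (cases "A = {}")
    case False
    then obtain x where x: "x \<in> A" by blast
    let ?B = "A - {x, h x}"
    have pair: "{x, h x} \<subseteq> A" "card {x, h x} = 2"
      using less.prems(2)[OF x] less.prems(4)[OF x] x by auto
    then have card: "card A = card ?B + 2"
      using less.prems(1) card_mono[OF less.prems(1) pair(1)] by (simp add: card_Diff_subset)
    have "even (card ?B)"
    proof (rule less.hyps)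
      fix y assume y: "y \<in> ?B"
      have hy: "h y \<in> A" "h (h y) = y" "h (h x) = x" using less.prems y x by auto
      then have "h y \<noteq> x" "h y \<noteq> h x" using y by auto
      then show "h y \<in> ?B" using hy by blast
    qed (use less.prems card in auto)
    then show ?thesis using card by simp
  qed simp
qed

text \<open>
  Here \<open>V\<close> is the vertex set, \<open>F\<close> the triangle-factor, \<open>N\<close> the open neighbourhood, and \<open>mate x\<close> the
  neighbour of \<open>x\<close> outside the triangle of \<open>x\<close>.
\<close>

locale triangle_tiling =
  fixes V :: "'a set" and F :: "'a set set" and N :: "'a \<Rightarrow> 'a set" and mate :: "'a \<Rightarrow> 'a"
  assumes finite_V: "finite V"
    and Union_F: "\<Union> F = V"
    and card_tri: "T \<in> F \<Longrightarrow> card T = 3"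
    and disjoint: "T \<in> F \<Longrightarrow> T' \<in> F \<Longrightarrow> T \<noteq> T' \<Longrightarrow> T \<inter> T' = {}"
    and mate_in: "x \<in> V \<Longrightarrow> mate x \<in> V"
    and mate_mate: "x \<in> V \<Longrightarrow> mate (mate x) = x"
    and mate_outside: "T \<in> F \<Longrightarrow> x \<in> T \<Longrightarrow> mate x \<notin> T"
    and nbhd: "T \<in> F \<Longrightarrow> x \<in> T \<Longrightarrow> N x = insert (mate x) (T - {x})"
begin

lemma finite_F: "finite F"
  using finite_V Union_F finite_UnionD by metis

lemma finite_tri: "T \<in> F \<Longrightarrow> finite T"
  using card_tri by (metis card.infinite zero_neq_numeral)

lemma tri_subset: "T \<in> F \<Longrightarrow> T \<subseteq> V"
  using Union_F by blast

lemma tri_unique: "T \<in> F \<Longrightarrow> T' \<in> F \<Longrightarrow> x \<in> T \<Longrightarrow> x \<in> T' \<Longrightarrow> T = T'"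
  using disjoint by blast

lemma mate_neq: "x \<in> V \<Longrightarrow> mate x \<noteq> x"
  using Union_F mate_outside by fastforce

lemma nbhd3:
  assumes "{x, y, z} \<in> F" "distinct [x, y, z]"
  shows "N x = {mate x, y, z}" "N y = {mate y, x, z}" "N z = {mate z, x, y}" "x \<in> V" "y \<in> V" "z \<in> V"
  using nbhd[OF assms(1), of x] nbhd[OF assms(1), of y] nbhd[OF assms(1), of z] assms
    tri_subset[OF assms(1)]
  by auto

lemma card_Union:
  assumes "Y \<subseteq> F" shows "card (\<Union> Y) = 3 * card Y"
proof -
  have "card (\<Union> Y) = sum card Y"
  proof (rule card_Union_disjoint)
    show "pairwise disjnt Y"
    proof (rule pairwiseI)
      fix T T' assume "T \<in> Y" "T' \<in> Y" "T \<noteq> T'"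
      then show "disjnt T T'" using assms unfolding disjnt_def by (intro disjoint) auto
    qed
  qed (use assms finite_tri in blast)
  also have "\<dots> = 3 * card Y"
    using assms card_tri by (simp add: subset_iff)
  finally show ?thesis .
qed

lemma even_card_V: "even (card V)"
  using even_card_involution[OF finite_V, of mate] mate_in mate_mate mate_neq by blast

text \<open>
  The darts of the sub-multigraph induced by \<open>Y\<close> after contraction: its number of edges is half the
  size of \<open>inner Y\<close>, and the degree of the point \<open>T\<close> in it is \<open>card (T \<inter> inner Y)\<close>.
\<close>

definition inner :: "'a set set \<Rightarrow> 'a set" where
  "inner Y = {x \<in> \<Union> Y. mate x \<in> \<Union> Y}"

lemma finite_inner: "Y \<subseteq> F \<Longrightarrow> finite (inner Y)"
  using finite_subset[OF _ finite_V, of "inner Y"] Union_F by (auto simp: inner_def)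

lemma mate_inner: "Y \<subseteq> F \<Longrightarrow> x \<in> inner Y \<Longrightarrow> mate x \<in> inner Y"
  using mate_mate[of x] Union_F by (force simp: inner_def)

lemma even_card_inner:
  assumes "Y \<subseteq> F" shows "even (card (inner Y))"
proof -
  have "inner Y \<subseteq> V" using assms Union_F by (auto simp: inner_def)
  then show ?thesis
    using even_card_involution[OF finite_inner[OF assms], of mate]
      mate_inner[OF assms] mate_mate mate_neq by blast
qed

lemma card_inner:
  assumes "Y \<subseteq> F" shows "card (inner Y) = (\<Sum>T\<in>Y. card (T \<inter> inner Y))"
proof -
  have "inner Y = (\<Union>T\<in>Y. T \<inter> inner Y)" by (auto simp: inner_def)
  then have "card (inner Y) = card (\<Union>T\<in>Y. T \<inter> inner Y)" by simp
  also have "\<dots> = (\<Sum>T\<in>Y. card (T \<inter> inner Y))"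
  proof (rule card_UN_disjoint)
    show "\<forall>T\<in>Y. \<forall>T'\<in>Y. T \<noteq> T' \<longrightarrow> (T \<inter> inner Y) \<inter> (T' \<inter> inner Y) = {}"
    proof (intro ballI impI)
      fix T T' assume "T \<in> Y" "T' \<in> Y" "T \<noteq> T'"
      then have "T \<inter> T' = {}" using assms by (intro disjoint) auto
      then show "(T \<inter> inner Y) \<inter> (T' \<inter> inner Y) = {}" by blast
    qed
    show "\<forall>T\<in>Y. finite (T \<inter> inner Y)" using assms finite_tri by blast
  qed (rule finite_subset[OF assms finite_F])
  finally show ?thesis .
qed

text \<open>
  Deleting the point \<open>T\<close> destroys the edges at \<open>T\<close>, and each of them has two darts.
\<close>

lemma card_inner_remove:
  assumes "Y \<subseteq> F" "T \<in> Y"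
  shows "card (inner Y) \<le> card (inner (Y - {T})) + 2 * card (T \<inter> inner Y)"
proof -
  let ?L = "T \<inter> inner Y"
  have "T \<in> F" using assms by blast
  then have fin: "finite ?L" using finite_tri[of T] by simp
  have "finite (inner (Y - {T}))"
    by (rule finite_inner) (use assms(1) in blast)
  note fin = fin this
  have "inner Y \<subseteq> inner (Y - {T}) \<union> (?L \<union> mate ` ?L)"
  proof
    fix x assume x: "x \<in> inner Y"
    have "x \<in> V" using x assms(1) Union_F unfolding inner_def by blast
    then have mm: "x = mate (mate x)" using mate_mate by simp
    have mx: "mate x \<in> inner Y" using assms(1) x by (rule mate_inner)
    consider "x \<in> T" | "mate x \<in> T" | "x \<notin> T" "mate x \<notin> T" by blast
    then show "x \<in> inner (Y - {T}) \<union> (?L \<union> mate ` ?L)"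
    proof cases
      case 2
      then have "mate (mate x) \<in> mate ` ?L" using mx by blast
      then show ?thesis using mm by simp
    next
      case 3
      then show ?thesis using x unfolding inner_def by blast
    qed (use x in blast)
  qed
  then have "card (inner Y) \<le> card (inner (Y - {T}) \<union> (?L \<union> mate ` ?L))"
    using fin by (intro card_mono) auto
  also have "\<dots> \<le> card (inner (Y - {T})) + (card ?L + card (mate ` ?L))"
    by (rule order_trans[OF card_Un_le]) (simp add: card_Un_le)
  also have "\<dots> \<le> card (inner (Y - {T})) + 2 * card ?L"
    using card_image_le[OF fin(1), of mate] by simp
  finally show ?thesis .
qed

end

section \<open>An induced cycle of triangles\<close>

context triangle_tiling
begin

text \<open>
  Minimum degree at least two in the contracted multigraph.
\<close>

definition leafless :: "'a set set \<Rightarrow> bool" where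
  "leafless Y \<longleftrightarrow> Y \<noteq> {} \<and> (\<forall>T \<in> Y. 2 \<le> card (T \<inter> inner Y))"

text \<open>
  A multigraph with at least as many edges as points contains a nonempty subgraph of minimum degree
  two: removing a point of degree at most one preserves the inequality, and a single point has no
  edges, as there are no loops.
\<close>

lemma leafless_subfamily:
  assumes "Y \<subseteq> F" "Y \<noteq> {}" "2 * card Y \<le> card (inner Y)"
  shows "\<exists>X \<subseteq> Y. leafless X"
  using assms
proof (induction "card Y" arbitrary: Y rule: less_induct)
  case less
  have finY: "finite Y" using less.prems(1) finite_F finite_subset by blast
  show ?case
  proof (cases "leafless Y")
    case False
    then obtain T where T: "T \<in> Y" "card (T \<inter> inner Y) \<le> 1"
      using less.prems(2) unfolding leafless_def by fastforce
    let ?Z = "Y - {T}"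
    have cZ: "card Y = Suc (card ?Z)" using T finY by (metis card.remove)
    have "Y \<noteq> {T}"
    proof
      assume "Y = {T}"
      then have "inner Y = {}" using less.prems(1) mate_outside by (auto simp: inner_def)
      then show False using less.prems(3) cZ by simp
    qed
    then have ne: "?Z \<noteq> {}" using T by blast
    have "2 * card ?Z \<le> card (inner ?Z)"
      using card_inner_remove[OF less.prems(1) T(1)] T(2) less.prems(3) cZ by linarith
    then obtain X where "X \<subseteq> ?Z" "leafless X"
      using less.hyps[of ?Z] ne cZ less.prems(1) by auto
    then show ?thesis by blast
  qed blast
qed

text \<open>
  Among the \<open>3 * card F\<close> darts only those at \<open>U\<close> and their mates are lost.
\<close>

lemma card_inner_remove_one:
  assumes "U \<in> F"
  shows "3 * card F \<le> card (inner (F - {U})) + 6"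
proof -
  have finU: "finite U" using assms finite_tri by blast
  have "V - (U \<union> mate ` U) \<subseteq> inner (F - {U})"
  proof
    fix x assume x: "x \<in> V - (U \<union> mate ` U)"
    then have mx: "mate x \<in> V" "x = mate (mate x)" using mate_in mate_mate by auto
    have "mate x \<notin> U"
    proof
      assume "mate x \<in> U"
      then have "mate (mate x) \<in> mate ` U" by (rule imageI)
      then show False using x mx(2) by simp
    qed
    then show "x \<in> inner (F - {U})" using x Union_F mx(1) unfolding inner_def by blast
  qed
  then have "card (V - (U \<union> mate ` U)) \<le> card (inner (F - {U}))"
    using finite_inner[of "F - {U}"] by (intro card_mono) auto
  moreover have "card V - card (U \<union> mate ` U) \<le> card (V - (U \<union> mate ` U))"
    using finU by (intro diff_card_le_card_Diff) auto
  moreover have "card (U \<union> mate ` U) \<le> 6"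
    using card_Un_le[of U "mate ` U"] card_image_le[OF finU, of mate] card_tri[OF assms] by linarith
  ultimately show ?thesis using card_Union[of F] Union_F by simp
qed

text \<open>
  Take a leafless family \<open>X\<close> avoiding \<open>U\<close> with as few triangles as possible. If some point of \<open>X\<close> has
  degree three, then, the number of darts being even, \<open>X\<close> has more edges than points. Deleting a
  point of degree two would still leave enough edges for a smaller leafless family; so all degrees
  are three, which makes \<open>X\<close> closed under \<open>mate\<close>, and by connectedness \<open>X\<close> contains \<open>U\<close>.

  The four triangles are needed for the edge count: deleting \<open>U\<close> leaves at least \<open>3 * card F - 6\<close> darts,
  which is at least \<open>2 * (card F - 1)\<close>.
\<close>

lemma induced_cycle:
  assumes "U \<in> F" and large: "4 \<le> card F"
    and conn: "\<And>Y. Y \<subseteq> F \<Longrightarrow> Y \<noteq> {} \<Longrightarrow> mate ` \<Union> Y \<subseteq> \<Union> Y \<Longrightarrow> Y = F"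
  shows "\<exists>X \<subseteq> F. X \<noteq> {} \<and> U \<notin> X \<and> (\<forall>T \<in> X. card (T \<inter> inner X) = 2)"
proof -
  have "card (F - {U}) = card F - 1" using assms(1) finite_F by simp
  then have "card (F - {U}) \<noteq> 0" "2 * card (F - {U}) \<le> card (inner (F - {U}))"
    using card_inner_remove_one[OF assms(1)] large by linarith+
  then obtain X0 where "X0 \<subseteq> F - {U}" "leafless X0"
    using leafless_subfamily[of "F - {U}"] by (metis Diff_subset card.empty)
  then obtain X where X: "X \<subseteq> F - {U}" "leafless X"
    and least: "\<And>Z. Z \<subseteq> F - {U} \<Longrightarrow> leafless Z \<Longrightarrow> card X \<le> card Z"
    using ex_has_least_nat[of "\<lambda>Z. Z \<subseteq> F - {U} \<and> leafless Z" X0 card] by metis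
  have XF: "X \<subseteq> F" "X \<noteq> {}" using X by (auto simp: leafless_def)
  have finX: "finite X" using XF finite_F finite_subset by blast
  have two: "2 \<le> card (T \<inter> inner X)" if "T \<in> X" for T using that X by (simp add: leafless_def)
  have three: "card (T \<inter> inner X) \<le> 3" if "T \<in> X" for T
    using card_mono[OF finite_tri, of T "T \<inter> inner X"] card_tri that XF by fastforce
  have "card (T \<inter> inner X) = 2" if T: "T \<in> X" for T
  proof (rule ccontr)
    assume "card (T \<inter> inner X) \<noteq> 2"
    then have T3: "card (T \<inter> inner X) > 2" using two[OF T] by simp
    have "(\<Sum>T\<in>X. 2) < card (inner X)"
      unfolding card_inner[OF XF(1)] using finX two T T3 by (intro sum_strict_mono_ex1) auto
    then have many: "2 * card X + 2 \<le> card (inner X)"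
      using even_card_inner[OF XF(1)] by (auto elim!: evenE)
    have all3: "card (Q \<inter> inner X) = 3" if Q: "Q \<in> X" for Q
    proof (rule ccontr)
      assume "card (Q \<inter> inner X) \<noteq> 3"
      then have Q2: "card (Q \<inter> inner X) = 2" using two[OF Q] three[OF Q] by simp
      let ?Z = "X - {Q}"
      have cZ: "card X = Suc (card ?Z)" using Q finX by (metis card.remove)
      have "Q \<noteq> T" using Q2 T3 by auto
      then have "?Z \<noteq> {}" using T by blast
      moreover have "2 * card ?Z \<le> card (inner ?Z)"
        using card_inner_remove[OF XF(1) Q] Q2 many cZ by linarith
      ultimately obtain Z where "Z \<subseteq> ?Z" "leafless Z"
        using leafless_subfamily[of ?Z] XF by blast
      moreover from this have "card Z \<le> card ?Z" using finX by (simp add: card_mono)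
      ultimately show False using least[of Z] X cZ by auto
    qed
    have "mate ` \<Union> X \<subseteq> \<Union> X"
    proof safe
      fix x Q assume Q: "x \<in> Q" "Q \<in> X"
      have "Q \<inter> inner X = Q"
        using all3[OF Q(2)] card_tri[of Q] Q XF finite_tri[of Q] by (intro card_subset_eq) auto
      then show "mate x \<in> \<Union> X" using Q by (auto simp: inner_def)
    qed
    then have "X = F" using conn XF by blast
    then show False using X assms(1) by blast
  qed
  moreover have "U \<notin> X" using X(1) by blast
  ultimately show ?thesis using XF by blast
qed

end

section \<open>Staller wins around an induced cycle\<close>

text \<open>
  Being 2-regular, \<open>X\<close> is a disjoint union of induced cycles of the contracted multigraph, where two
  parallel edges count as a cycle of length two.
\<close>

locale cycle_in_tiling = triangle_tiling +
  fixes X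
  assumes X_subset: "X \<subseteq> F"
    and two_inner: "T \<in> X \<Longrightarrow> card (T \<inter> inner X) = 2"
begin

abbreviation staller_forces :: "'a set \<Rightarrow> 'a set \<Rightarrow> bool" where
  "staller_forces \<equiv> forces V (encloses V N)"

lemma X_in_V: "x \<in> \<Union> X \<Longrightarrow> x \<in> V"
  using X_subset Union_F by blast

lemma tri_exit:
  assumes "T \<in> X" "x \<in> T" "x \<in> inner X"
  obtains p q where "T = {x, p, q}" "distinct [x, p, q]" "p \<in> inner X" "q \<notin> inner X"
proof -
  have TF: "T \<in> F" using assms X_subset by blast
  have fin: "finite T" using finite_tri[OF TF] .
  obtain u w where uw: "T \<inter> inner X = {u, w}" "u \<noteq> w"
    using two_inner[OF assms(1)] by (auto simp: card_2_iff)
  have "x \<in> {u, w}" using uw assms by blast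
  then obtain p where p: "T \<inter> inner X = {x, p}" "p \<noteq> x"
    using uw by blast
  have "card (T - {x, p}) = 1"
    using p card_tri[OF TF] fin by (subst card_Diff_subset) auto
  then obtain q where q: "T - {x, p} = {q}" by (rule card_1_singletonE)
  show thesis
  proof (rule that)
    show "T = {x, p, q}" "distinct [x, p, q]" "p \<in> inner X" "q \<notin> inner X"
      using p q by auto
  qed
qed

text \<open>
  The forced walk. \<open>W\<close> is the set of triangles visited so far; the only cycle edges leaving \<open>W\<close> start at
  \<open>s\<close>, owned by Staller, and at \<open>b\<close>, through which the walk has to come back. The triangles of \<open>X\<close> not
  yet visited are free, except that Dominator may own \<open>mate s\<close>: the walk never claims that vertex.
  The walk stops in front of the triangle \<open>{mate s', mate b, q}\<close> that closes the cycle; the last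
  hypothesis says that Staller wins from there, whatever has been claimed on the way.
\<close>

lemma walk_along_cycle:
  assumes "W \<subseteq> X" "s \<in> \<Union> W" "mate s \<in> \<Union> X" "mate s \<notin> \<Union> W" "s \<in> S"
    and "b \<in> \<Union> W" "mate b \<notin> \<Union> W" "s \<noteq> b"
    and "\<And>x. x \<in> \<Union> W \<Longrightarrow> x \<in> inner X \<Longrightarrow> mate x \<in> \<Union> W \<or> x = s \<or> x = b"
    and "S \<inter> (\<Union> X - \<Union> W) = {}" "D \<inter> (\<Union> X - \<Union> W) \<subseteq> {mate s}"
    and "\<And>S' D' s' q. S \<subseteq> S' \<Longrightarrow> S' \<subseteq> S \<union> (\<Union> X - \<Union> W) \<Longrightarrow> D' \<subseteq> D \<union> (\<Union> X - \<Union> W) \<Longrightarrow>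
      s' \<in> S' \<Longrightarrow> {mate s', mate b, q} \<in> X \<Longrightarrow> distinct [mate s', mate b, q] \<Longrightarrow> {mate s', mate b, q} \<inter> \<Union> W = {} \<Longrightarrow>
      {mate s', mate b, q} \<inter> S' = {} \<Longrightarrow> {mate s', mate b, q} \<inter> D' \<subseteq> D \<inter> {mate s'} \<Longrightarrow> staller_forces S' D'"
  shows "staller_forces S D"
  using assms
proof (induction "card (X - W)" arbitrary: W s S D rule: less_induct)
  case less
  note W = less.prems(1) and s = less.prems(2-5) and b = less.prems(6-8)
    and exits = less.prems(9) and free = less.prems(10,11) and ending = less.prems(12)
  obtain Q where Q: "Q \<in> X" "mate s \<in> Q" using s by blast
  have QF: "Q \<in> F" and WF: "W \<subseteq> F" using Q W X_subset by blast+
  have disj: "Q \<inter> T = {}" if "T \<in> W" for T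
    using disjoint[OF QF, of T] that WF s(3) Q(2) by blast
  have QW: "Q \<inter> \<Union> W = {}" "Q \<notin> W" using disj Q by blast+
  have WV: "\<Union> W \<subseteq> \<Union> X" using W by blast
  have sV: "s \<in> V" and bV: "b \<in> V" using s b WV X_in_V by blast+
  have mms: "mate (mate s) = s" and mmb: "mate (mate b) = b" using mate_mate sV bV by auto
  have msi: "mate s \<in> inner X" using s(1,2) WV mms unfolding inner_def by auto
  obtain p q where pq: "Q = {mate s, p, q}" "distinct [mate s, p, q]" "p \<in> inner X" "q \<notin> inner X"
    by (rule tri_exit[OF Q msi])
  have Nms: "N (mate s) = {s, p, q}" using nbhd3(1)[of "mate s" p q] pq QF mms by simp
  have inV: "mate s \<in> V" "p \<in> V" "q \<in> V" using pq(1) Q(1) X_in_V by blast+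
  have pqfree: "p \<in> V - S - D" "q \<in> V - S - D" using pq Q QW free inV by auto
  show ?case
  proof (cases "p = mate b")
    case True
    show ?thesis
    proof (rule ending[of S D s q])
      show "{mate s, mate b, q} \<in> X" "distinct [mate s, mate b, q]" "{mate s, mate b, q} \<inter> \<Union> W = {}"
        "{mate s, mate b, q} \<inter> S = {}" "{mate s, mate b, q} \<inter> D \<subseteq> D \<inter> {mate s}"
        using pq Q QW free True by auto
    qed (use s in auto)
  next
    case False
    let ?W = "insert Q W"
    have mpX: "mate p \<in> \<Union> X" using pq(3) by (simp add: inner_def)
    have mmp: "mate (mate p) = p" using mate_mate inV by blast
    have pW: "p \<notin> \<Union> W" using QW pq(1) by blast
    have mpW: "mate p \<notin> \<Union> W"
    proof
      assume mp: "mate p \<in> \<Union> W"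
      have "mate p \<in> inner X" using mate_inner[OF X_subset pq(3)] .
      then consider "mate (mate p) \<in> \<Union> W" | "mate p = s" | "mate p = b" using exits[OF mp] by blast
      then show False
        by cases (use pW mmp False pq(2) in auto)
    qed
    have mbQ: "mate b \<notin> Q"
    proof
      assume mb: "mate b \<in> Q"
      then have "mate b \<in> inner X" using Q(1) b(1) WV mmb by (auto simp: inner_def)
      then have "mate b = mate s" using mb pq False by auto
      then have "b = s" using mms mmb by metis
      then show False using b(3) by simp
    qed
    have "staller_forces (insert p S) (insert q D)"
    proof (rule less.hyps[of ?W])
      have "X - ?W \<subset> X - W" using Q QW by blast
      moreover have "finite X" using finite_F X_subset finite_subset by blast
      ultimately show "card (X - ?W) < card (X - W)" by (simp add: psubset_card_mono)
      show "?W \<subseteq> X" "p \<in> \<Union> ?W" "mate p \<in> \<Union> X" "p \<in> insert p S" "b \<in> \<Union> ?W"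
        using Q W pq(1) mpX b by auto
      have "mate p \<notin> Q" using mate_outside[OF QF] pq(1) by blast
      then show "mate p \<notin> \<Union> ?W" using mpW by blast
      show "mate b \<notin> \<Union> ?W" using mbQ b by blast
      show "p \<noteq> b" using pW b by blast
      show "insert p S \<inter> (\<Union> X - \<Union> ?W) = {}" "insert q D \<inter> (\<Union> X - \<Union> ?W) \<subseteq> {mate p}"
        using free pq(1) by auto
    next
      fix x assume x: "x \<in> \<Union> ?W" "x \<in> inner X"
      show "mate x \<in> \<Union> ?W \<or> x = p \<or> x = b"
      proof (cases "x \<in> Q")
        case True
        then have "x = mate s \<or> x = p" using pq x by auto
        then show ?thesis using mms s(1) by auto
      next
        case False
        then have "mate x \<in> \<Union> W \<or> x = s \<or> x = b" using exits[of x] x by blast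
        then show ?thesis using Q(2) by blast
      qed
    next
      fix S' D' s' r
      assume h: "insert p S \<subseteq> S'" "S' \<subseteq> insert p S \<union> (\<Union> X - \<Union> ?W)"
        "D' \<subseteq> insert q D \<union> (\<Union> X - \<Union> ?W)" "s' \<in> S'" "{mate s', mate b, r} \<in> X"
        "distinct [mate s', mate b, r]" "{mate s', mate b, r} \<inter> \<Union> ?W = {}" "{mate s', mate b, r} \<inter> S' = {}"
        "{mate s', mate b, r} \<inter> D' \<subseteq> insert q D \<inter> {mate s'}"
      have pqX: "p \<in> \<Union> X - \<Union> W" "q \<in> \<Union> X - \<Union> W" using pq(1) Q(1) QW by auto
      show "staller_forces S' D'"
      proof (rule ending[of S' D' s' r])
        show "S \<subseteq> S'" "S' \<subseteq> S \<union> (\<Union> X - \<Union> W)" "D' \<subseteq> D \<union> (\<Union> X - \<Union> W)"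
          using h(1-3) pqX by auto
        have "q \<noteq> mate s'" using h(7) pq(1) by auto
        then show "{mate s', mate b, r} \<inter> D' \<subseteq> D \<inter> {mate s'}" using h(9) by auto
      qed (use h in auto)
    qed
    then show ?thesis
      using forced_reply[of "mate s" V N p q S D] Nms s(4) inV pqfree pq(2) by auto
  qed
qed

text \<open>
  Dominator's answer \<open>z\<close> to Staller's \<open>a\<close> decides how she goes on. If \<open>z\<close> is \<open>mate a\<close>, \<open>mate c\<close> or \<open>b\<close>,
  she walks around the cycle and closes it by claiming \<open>mate b\<close>, which besides the usual threat
  produces one at \<open>c\<close> by the neighbourhood \<open>{a, c, mate b}\<close> of \<open>b\<close>. If \<open>z\<close> is \<open>c\<close>, she plays \<open>b\<close> first,
  forcing \<open>mate c\<close>, and then walks from \<open>a\<close>; the last triangle \<open>{mate s', mate b, q}\<close> is then approached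
  from both sides, and claiming \<open>q\<close> makes a double threat. If \<open>z\<close> is \<open>mate b\<close>, she turns to the triangle
  of \<open>mate a\<close>. Any other answer loses at once: \<open>b\<close> forces \<open>mate c\<close>, and \<open>c\<close> then threatens both \<open>mate a\<close>
  and \<open>mate b\<close>.
\<close>

lemma cycle_wins:
  assumes T: "{a, b, c} \<in> X" and dist: "distinct [a, b, c]"
    and ab: "a \<in> inner X" "b \<in> inner X" and c: "c \<notin> inner X"
    and D: "D \<inter> \<Union> X = {}" "mate c \<notin> D" and z: "z \<noteq> a"
  shows "staller_forces {a} (insert z D)"
proof -
  let ?T = "{a, b, c}"
  have TF: "?T \<in> F" using T X_subset by blast
  note N3 = nbhd3[OF TF dist]
  have abcX: "a \<in> \<Union> X" "b \<in> \<Union> X" "c \<in> \<Union> X" using T by blast+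
  have mV: "mate a \<in> V" "mate b \<in> V" "mate c \<in> V" by (simp_all add: N3(4-6) mate_in)
  have mm: "mate (mate a) = a" "mate (mate b) = b" "mate (mate c) = c" by (simp_all add: N3(4-6) mate_mate)
  have mX: "mate a \<in> \<Union> X" "mate b \<in> \<Union> X" "mate c \<notin> \<Union> X" using ab c abcX by (auto simp: inner_def)
  have mT: "mate a \<notin> ?T" "mate b \<notin> ?T" "mate c \<notin> ?T"
    by (rule mate_outside[OF TF], simp)+
  have mdist: "mate a \<noteq> mate b" "mate a \<noteq> mate c" "mate b \<noteq> mate c" using mm dist by auto
  have XD: "x \<notin> D" if "x \<in> \<Union> X" for x using D(1) that by blast
  have freeD: "a \<notin> D" "b \<notin> D" "c \<notin> D" "mate a \<notin> D" "mate b \<notin> D"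
    by (rule XD, fact)+
  have eq: "\<Union> {?T} = ?T" by simp
  have walk: "staller_forces S E"
    if S: "a \<in> S" "S \<subseteq> {a, b}" and E: "E \<inter> (\<Union> X - ?T) \<subseteq> {mate a}"
      and ending: "\<And>S' E' s' q. S \<subseteq> S' \<Longrightarrow> S' \<subseteq> S \<union> (\<Union> X - ?T) \<Longrightarrow> E' \<subseteq> E \<union> (\<Union> X - ?T) \<Longrightarrow>
      s' \<in> S' \<Longrightarrow> {mate s', mate b, q} \<in> X \<Longrightarrow> distinct [mate s', mate b, q] \<Longrightarrow> {mate s', mate b, q} \<inter> ?T = {} \<Longrightarrow>
      {mate s', mate b, q} \<inter> S' = {} \<Longrightarrow> {mate s', mate b, q} \<inter> E' \<subseteq> E \<inter> {mate s'} \<Longrightarrow> staller_forces S' E'"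
    for S E
  proof (rule walk_along_cycle[of "{?T}" a S b E, unfolded eq])
    show "{?T} \<subseteq> X" "a \<in> ?T" "mate a \<in> \<Union> X" "mate a \<notin> ?T" "a \<in> S" "b \<in> ?T" "mate b \<notin> ?T" "a \<noteq> b"
      using T dist mX mT S(1) by simp_all
    show "S \<inter> (\<Union> X - ?T) = {}" using S(2) by blast
    show "mate x \<in> ?T \<or> x = a \<or> x = b" if "x \<in> ?T" "x \<in> inner X" for x
      using that c by blast
  qed (use E in assumption, rule ending)
  have "z \<in> {mate a, mate c, b} \<or> z = c \<or> z = mate b \<or> z \<notin> {a, b, c, mate a, mate b, mate c}" using z by blast
  then consider "z \<in> {mate a, mate c, b}" | "z = c" | "z = mate b" | "z \<notin> {a, b, c, mate a, mate b, mate c}" by blast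
  then show ?thesis
  proof cases
    case 1
    show ?thesis
    proof (rule walk)
      show "insert z D \<inter> (\<Union> X - ?T) \<subseteq> {mate a}" using 1 D mX by auto
      fix S' E' s' q
      assume h: "{a} \<subseteq> S'" "S' \<subseteq> {a} \<union> (\<Union> X - ?T)" "E' \<subseteq> insert z D \<union> (\<Union> X - ?T)"
        "s' \<in> S'" "{mate s', mate b, q} \<in> X" "distinct [mate s', mate b, q]" "{mate s', mate b, q} \<inter> ?T = {}"
        "{mate s', mate b, q} \<inter> S' = {}" "{mate s', mate b, q} \<inter> E' \<subseteq> insert z D \<inter> {mate s'}"
      have QF: "{mate s', mate b, q} \<in> F" using h(5) X_subset by blast
      have "s' \<in> V" using h(2,4) N3 X_in_V by blast
      then have Nq: "N (mate s') = {s', mate b, q}" using nbhd3(1)[OF QF h(6)] mate_mate by simp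
      note Q = nbhd3[OF QF h(6)]
      have "mate b \<in> V - S' - E'" "q \<in> V - S' - E'" using Q h(6,8,9) by auto
      moreover have "c \<notin> insert z D" using 1 mT dist freeD by auto
      then have "c \<in> V - S' - E'" using h(2,3) dist N3 by auto
      ultimately show "staller_forces S' E'"
        using double_threat[of "mate b" V S' E' q c "mate s'" N b] Nq N3(2) Q(4) N3(5) h(1,4,6,7) by auto
    qed auto
  next
    case 2
    have "staller_forces (insert b {a}) (insert (mate c) (insert z D))"
    proof (rule walk)
      show "insert (mate c) (insert z D) \<inter> (\<Union> X - ?T) \<subseteq> {mate a}" using 2 D mX by auto
      fix S' E' s' q
      assume h: "insert b {a} \<subseteq> S'" "S' \<subseteq> insert b {a} \<union> (\<Union> X - ?T)"
        "E' \<subseteq> insert (mate c) (insert z D) \<union> (\<Union> X - ?T)"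
        "s' \<in> S'" "{mate s', mate b, q} \<in> X" "distinct [mate s', mate b, q]" "{mate s', mate b, q} \<inter> ?T = {}"
        "{mate s', mate b, q} \<inter> S' = {}" "{mate s', mate b, q} \<inter> E' \<subseteq> insert (mate c) (insert z D) \<inter> {mate s'}"
      have QF: "{mate s', mate b, q} \<in> F" using h(5) X_subset by blast
      have "s' \<in> V" using h(2,4) N3 X_in_V by blast
      then have Nq: "N (mate s') = {s', mate b, q}" using nbhd3(1)[OF QF h(6)] mate_mate by simp
      note Q = nbhd3[OF QF h(6)]
      have Nb: "N (mate b) = {b, mate s', q}" using Q(2) mm by simp
      have "mate s' \<notin> insert (mate c) (insert z D)" using h(5,7) D mX 2 by auto
      then have "mate b \<in> V - S' - E'" "q \<in> V - S' - E'" "mate s' \<in> V - S' - E'" using Q h(6,8,9) by auto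
      then show "staller_forces S' E'"
        using double_threat[of q V S' E' "mate b" "mate s'" "mate s'" N "mate b"] Nq Nb Q(4,5) h(1,4,6) by auto
    qed auto
    then show ?thesis
      using forced_reply[of c V N b "mate c" "{a}" "insert z D"] N3 mV 2 dist freeD D mT by auto
  next
    case 3
    show ?thesis
    \<comment> \<open>If the cycle has length two, then after the exchange of b for mate c the vertex mate a
      threatens c by N a and e by N (mate b). Otherwise mate b lies elsewhere, and the exchanges of
      e for d and of mate a for mate d, where d leads on along the cycle, complete the preparation:
      with a and mate a claimed, b threatens c by N a and mate c by N c.\<close>
    proof (cases "\<exists>e. {mate a, mate b, e} \<in> X \<and> distinct [mate a, mate b, e]")
      case True
      then obtain e where e: "{mate a, mate b, e} \<in> X" "distinct [mate a, mate b, e]" by blast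
      have QF: "{mate a, mate b, e} \<in> F" using e(1) X_subset by blast
      note Q = nbhd3[OF QF e(2)]
      have ne: "e \<notin> ?T" using tri_unique[OF TF QF, of e] mT by blast
      have "e \<in> \<Union> X" using e(1) by blast
      then have eD: "e \<notin> D" "e \<noteq> mate c" using D mX by blast+
      have "staller_forces (insert b {a}) (insert (mate c) (insert z D))"
      proof (rule double_threat[of "mate a" _ _ _ c e a _ "mate b"])
        show "N a \<subseteq> insert (mate a) (insert c (insert b {a}))" "N (mate b) \<subseteq> insert (mate a) (insert e (insert b {a}))"
          using N3 Q mm by auto
        show "mate a \<in> V - insert b {a} - insert (mate c) (insert z D)"
          using mV mT freeD mdist 3 by auto
        show "c \<in> V - insert b {a} - insert (mate c) (insert z D)"
          using N3 mT freeD 3 dist by auto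
        show "e \<in> V - insert b {a} - insert (mate c) (insert z D)"
          using Q ne eD 3 e(2) by auto
        show "mate a \<noteq> c" "mate a \<noteq> e" "c \<noteq> e" using mT e(2) ne by auto
      qed (use N3 mV in auto)
      then show ?thesis
        using forced_reply[of c V N b "mate c" "{a}" "insert z D"] N3 mV 3 dist freeD D mT mdist by auto
    next
      case False
      obtain Q where Q: "Q \<in> X" "mate a \<in> Q" using mX by blast
      have QF: "Q \<in> F" using Q X_subset by blast
      have mai: "mate a \<in> inner X" using mate_inner[OF X_subset ab(1)] .
      obtain d e where de: "Q = {mate a, d, e}" "distinct [mate a, d, e]" "d \<in> inner X" "e \<notin> inner X"
        by (rule tri_exit[OF Q mai])
      note NQ = nbhd3[OF QF[unfolded de(1)] de(2)]
      have mbQ: "mate b \<notin> Q"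
      proof
        assume "mate b \<in> Q"
        then have "mate b = d \<or> mate b = e" using de mdist by auto
        then show False
        proof
          assume "mate b = d"
          then show False using False Q(1) de by auto
        next
          assume "mate b = e"
          then have "{mate a, mate b, d} \<in> X" using Q(1) de(1) by (simp add: insert_commute)
          then show False using False de(2) \<open>mate b = e\<close> by auto
        qed
      qed
      have QT: "Q \<inter> ?T = {}" using tri_unique[OF TF QF, of "mate a"] disjoint[OF QF TF] Q(2) mT by blast
      have deX: "d \<in> \<Union> X" "e \<in> \<Union> X" using Q(1) de(1) by blast+
      have mdX: "mate d \<in> \<Union> X" using de(3) by (simp add: inner_def)
      have mdV: "mate d \<in> V" "mate (mate d) = d" using NQ(5) mate_in mate_mate by simp_all
      have mdQ: "mate d \<notin> Q" using mate_outside[OF QF] de(1) by blast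
      have md: "mate d \<noteq> a" "mate d \<noteq> b" "mate d \<noteq> c" "mate d \<noteq> mate b" "mate d \<noteq> mate c"
      proof -
        show "mate d \<noteq> a" using mdV de(2) by auto
        show "mate d \<noteq> b" using mdV mbQ de(1) by auto
        show "mate d \<noteq> c" using mdV deX mX by auto
        show "mate d \<noteq> mate b" using mdV mm QT de(1) by (metis disjoint_iff insertCI)
        show "mate d \<noteq> mate c" using mdX mX by auto
      qed
      have Dfree: "d \<notin> D" "e \<notin> D" "mate d \<notin> D" by (rule XD, fact)+
      let ?S1 = "insert e {a}" and ?E1 = "insert d (insert z D)"
      let ?S2 = "insert (mate a) ?S1" and ?E2 = "insert (mate d) ?E1"
      have out: "d \<notin> ?T" "e \<notin> ?T" "d \<noteq> mate b" "e \<noteq> mate b" "d \<noteq> mate c" "e \<noteq> mate c"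
        using QT de(1) mbQ deX mX by auto
      have "staller_forces ?S2 ?E2"
      proof (rule double_threat[of b _ _ _ c "mate c" a _ c])
        show "N a \<subseteq> insert b (insert c ?S2)" "N c \<subseteq> insert b (insert (mate c) ?S2)" using N3 by auto
        show "b \<in> V - ?S2 - ?E2" "c \<in> V - ?S2 - ?E2"
          using N3 dist out md mT freeD 3 by auto
        show "mate c \<in> V - ?S2 - ?E2"
          using mV out md mT mdist D(2) 3 by auto
        show "b \<noteq> c" "b \<noteq> mate c" "c \<noteq> mate c" using dist mT by auto
      qed (use N3 in auto)
      then have "staller_forces ?S1 ?E1"
      proof (rule forced_reply[of d, rotated -1])
        show "N d \<subseteq> insert (mate a) (insert (mate d) ?S1)" using NQ(2) by auto
        show "mate a \<in> V - ?S1 - ?E1" using mV mT freeD mdist 3 de(2) by auto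
        show "mate d \<in> V - ?S1 - ?E1" using mdV md mdQ de(1) Dfree 3 by auto
        show "mate a \<noteq> mate d" using mdQ de(1) by auto
      qed (use NQ in auto)
      then show ?thesis
      proof (rule forced_reply[of "mate a", rotated -1])
        show "N (mate a) \<subseteq> insert e (insert d {a})" using NQ(1) mm by auto
        show "e \<in> V - {a} - insert z D" "d \<in> V - {a} - insert z D" using NQ out Dfree 3 by auto
      qed (use NQ de(2) in auto)
    qed
  next
    case 4
    have "staller_forces (insert b {a}) (insert (mate c) (insert z D))"
    proof (rule double_threat[of c _ _ _ "mate a" "mate b" a _ b])
      show "N a \<subseteq> insert c (insert (mate a) (insert b {a}))" "N b \<subseteq> insert c (insert (mate b) (insert b {a}))"
        using N3 by auto
    qed (use N3 mV mT mdist dist freeD 4 in auto)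
    then show ?thesis
      using forced_reply[of c V N b "mate c" "{a}" "insert z D"] N3 mV 4 dist freeD D mT by auto
  qed
qed

end

context triangle_tiling
begin

text \<open>
  \<open>D\<close> is empty if Staller moves first and \<open>{u}\<close> if Dominator has opened with \<open>u\<close>; the cycle avoids the
  triangle of \<open>u\<close> in both cases.
\<close>

lemma Staller_forces:
  assumes large: "4 \<le> card F"
    and conn: "\<And>Y. Y \<subseteq> F \<Longrightarrow> Y \<noteq> {} \<Longrightarrow> mate ` \<Union> Y \<subseteq> \<Union> Y \<Longrightarrow> Y = F"
    and u: "u \<in> V" and D: "D \<subseteq> {u}"
  shows "forces V (encloses V N) {} D"
proof -
  obtain U where U: "U \<in> F" "u \<in> U" using u Union_F by blast
  have "\<exists>X \<subseteq> F. X \<noteq> {} \<and> U \<notin> X \<and> (\<forall>T \<in> X. card (T \<inter> inner X) = 2)"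
    by (rule induced_cycle[OF U(1) large]) (rule conn)
  then obtain X where X: "X \<subseteq> F" "X \<noteq> {}" "U \<notin> X" "\<And>T. T \<in> X \<Longrightarrow> card (T \<inter> inner X) = 2"
    by blast
  interpret cycle_in_tiling V F N mate X
    by unfold_locales (use X in auto)
  have uX: "u \<notin> \<Union> X" using X(1,3) U tri_unique by blast
  \<comment> \<open>Two triangles joined by an edge of the cycle have different vertices off the cycle, and at
    most one of these has mate u.\<close>
  obtain a b c where abc: "{a, b, c} \<in> X" "distinct [a, b, c]" "a \<in> inner X" "b \<in> inner X"
    "c \<notin> inner X" "mate c \<noteq> u"
  proof -
    obtain T where T: "T \<in> X" using X(2) by blast
    then obtain x where x: "x \<in> T" "x \<in> inner X"
      using X(4)[OF T] by (metis Int_iff card.empty ex_in_conv zero_neq_numeral)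
    obtain p q where pq: "T = {x, p, q}" "distinct [x, p, q]" "p \<in> inner X" "q \<notin> inner X"
      by (rule tri_exit[OF T x])
    have mx: "mate x \<in> inner X" using mate_inner[OF X(1) x(2)] .
    then obtain T' where T': "T' \<in> X" "mate x \<in> T'" unfolding inner_def by blast
    obtain p' q' where pq': "T' = {mate x, p', q'}" "distinct [mate x, p', q']" "p' \<in> inner X" "q' \<notin> inner X"
      by (rule tri_exit[OF T' mx])
    have TF: "T \<in> F" "T' \<in> F" using T T' X(1) by blast+
    have "q \<in> V" "q' \<in> V" using tri_subset[OF TF(1)] tri_subset[OF TF(2)] pq(1) pq'(1) by auto
    then have back_q: "mate (mate q) = q" "mate (mate q') = q'" using mate_mate by auto
    have "mate x \<notin> T" using mate_outside[OF TF(1)] x by blast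
    then have "T \<noteq> T'" using T' by blast
    then have "q \<noteq> q'" using disjoint[OF TF] pq(1) pq'(1) by blast
    then have "mate q \<noteq> u \<or> mate q' \<noteq> u" using back_q by metis
    then show thesis
    proof
      assume "mate q \<noteq> u"
      then show thesis using that[of x p q] T x pq by simp
    next
      assume "mate q' \<noteq> u"
      then show thesis using that[of "mate x" p' q'] T' mx pq' by simp
    qed
  qed
  have abX: "a \<in> \<Union> X" "b \<in> \<Union> X" using abc(1) by blast+
  then have abV: "a \<in> V" "b \<in> V" using X_in_V by auto
  have free: "a \<noteq> u" "b \<noteq> u" using abX uX by auto
  show ?thesis
  proof (rule forces_move[of a])
    show "a \<in> V - {} - D" using abV free D by blast
    show "awaits V (encloses V N) (insert a {}) D"
    proof (rule awaits_move)
      have "b \<in> V - insert a {} - D" using abV free D abc(2) by auto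
      then show "V - insert a {} - D \<noteq> {}" by blast
      fix z assume z: "z \<in> V - insert a {} - D"
      show "forces V (encloses V N) (insert a {}) (insert z D)"
        by (rule cycle_wins[OF abc(1-5)]) (use D uX abc(6) z in auto)
    qed
  qed
qed

end

section \<open>Dominator wins on the prism\<close>

context triangle_tiling
begin

text \<open>
  After claiming \<open>v\<close>, Dominator still has to meet \<open>N v\<close>, \<open>N (mate p)\<close> and \<open>N (mate q)\<close>, which all contain
  \<open>mate v\<close>. If Staller takes \<open>mate v\<close>, then \<open>q\<close> meets the first and the third, and the second,
  \<open>{p, mate v, mate q}\<close>, is met by \<open>p\<close> or by \<open>mate q\<close>. None of the vertices used is \<open>mate p\<close>, which
  Staller may therefore own from the start.
\<close>

lemma prism_Dominator:
  assumes F: "card F = 2" and T: "{v, p, q} \<in> F" "distinct [v, p, q]"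
    and C: "C \<subseteq> {mate p}" and w: "w \<in> V - {v} - C"
  shows "forces V (meets_all V N) {v} (insert w C)"
proof -
  obtain T' where F2: "F = {{v, p, q}, T'}" "T' \<noteq> {v, p, q}"
  proof -
    obtain A B where AB: "F = {A, B}" "A \<noteq> B" using F by (auto simp: card_2_iff)
    then have "{v, p, q} = A \<or> {v, p, q} = B" using T(1) by auto
    then show thesis using that AB by blast
  qed
  have T'F: "T' \<in> F" using F2 by blast
  have VV: "V = {v, p, q} \<union> T'" using F2(1) Union_F by auto
  have inV: "v \<in> V" "p \<in> V" "q \<in> V" using VV by auto
  have mm: "mate (mate v) = v" "mate (mate p) = p" "mate (mate q) = q" by (rule mate_mate, fact)+
  have mV: "mate v \<in> V" "mate p \<in> V" "mate q \<in> V" by (rule mate_in, fact)+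
  have out: "mate v \<notin> {v, p, q}" "mate p \<notin> {v, p, q}" "mate q \<notin> {v, p, q}"
    by (rule mate_outside[OF T(1)], simp)+
  have md: "distinct [mate v, mate p, mate q]" using mm T(2) by auto
  have "{mate v, mate p, mate q} \<subseteq> T'" using mV out VV by auto
  moreover have "card {mate v, mate p, mate q} = 3" using md by simp
  ultimately have T': "T' = {mate v, mate p, mate q}"
    using card_tri[OF T'F] finite_tri[OF T'F] by (metis card_subset_eq)
  note NT = nbhd3(1-3)[OF T]
  note NT' = nbhd3(1-3)[OF T'F[unfolded T'] md, unfolded mm]
  have V6: "V = {v, p, q, mate v, mate p, mate q}" using VV T' by auto
  have goal: "meets_all V N A" if "v \<in> A" "mate v \<in> A \<or> (q \<in> A \<and> (p \<in> A \<or> mate q \<in> A))" for A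
    using that unfolding meets_all_def V6 by (auto simp: NT NT')
  show ?thesis
  proof (cases "w = mate v")
    case False
    show ?thesis
      by (rule forces_move[of "mate v"], use mV out md C False in force)
        (rule awaits_done, rule goal, simp_all)
  next
    case True
    have q: "q \<in> V - {v} - insert w C" using inV T(2) True C out by auto
    show ?thesis
    proof (rule forces_move[OF q], rule awaits_move)
      have "p \<in> V - insert q {v} - insert w C" using inV T(2) True C out by auto
      then show "V - insert q {v} - insert w C \<noteq> {}" by blast
      fix z assume z: "z \<in> V - insert q {v} - insert w C"
      show "forces V (meets_all V N) (insert q {v}) (insert z (insert w C))"
      proof (cases "z = p")
        case True
        then show ?thesis
          by (intro forces_move[of "mate q"] awaits_done goal)
            (use mV out md C \<open>w = mate v\<close> in auto)
      next
        case False
        then show ?thesis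
          by (intro forces_move[of "p"] awaits_done goal)
            (use inV T(2) out md C \<open>w = mate v\<close> in auto)
      qed
    qed
  qed
qed

lemma Dominator_forces_first:
  assumes "card F = 2"
  shows "forces V (meets_all V N) {} {}"
proof -
  obtain T where T: "T \<in> F" using assms by fastforce
  then obtain v p q where vpq: "T = {v, p, q}" "distinct [v, p, q]"
    using card_tri[OF T] by (auto simp: card_3_iff)
  have inV: "v \<in> V" "p \<in> V" using tri_subset[OF T] vpq by auto
  show ?thesis
  proof (rule forces_move[of v], use inV in simp, rule awaits_move)
    have "p \<in> V - insert v {} - {}" using inV vpq by auto
    then show "V - insert v {} - {} \<noteq> {}" by blast
    fix w assume "w \<in> V - insert v {} - {}"
    then show "forces V (meets_all V N) {v} {w}"
      using prism_Dominator[OF assms T[unfolded vpq(1)] vpq(2), of "{}" w] by simp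
  qed
qed

text \<open>
  Dominator answers \<open>x\<close> by a vertex \<open>v\<close> whose triangle contains \<open>mate x\<close>: then \<open>x\<close> is the mate of a
  triangle companion of \<open>v\<close>, which is the one Staller vertex that \<open>prism_Dominator\<close> tolerates.
\<close>

lemma Dominator_awaits_second:
  assumes "card F = 2"
  shows "awaits V (meets_all V N) {} {}"
proof (rule awaits_move)
  have "card V = 6" using card_Union[of F] Union_F assms by simp
  then show "V - {} - {} \<noteq> {}" by auto
  fix x assume "x \<in> V - {} - {}"
  then have x: "x \<in> V" by simp
  have mx: "mate x \<in> V" "mate (mate x) = x" using mate_in mate_mate x by auto
  then obtain T where T: "T \<in> F" "mate x \<in> T" using Union_F by blast
  obtain v q where vq: "T = {v, mate x, q}" "distinct [v, mate x, q]"
  proof -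
    obtain r s t where "T = {r, s, t}" "distinct [r, s, t]"
      using card_tri[OF T(1)] by (auto simp: card_3_iff)
    moreover from this T(2) have "mate x = r \<or> mate x = s \<or> mate x = t" by blast
    ultimately show thesis using that[of r t] that[of s t] that[of t s] that[of r s] by auto
  qed
  have xT: "x \<notin> T" using mate_outside[OF T(1,2)] mx(2) by simp
  have inV: "v \<in> V" "q \<in> V" using tri_subset[OF T(1)] vq by auto
  show "forces V (meets_all V N) {} (insert x {})"
  proof (rule forces_move[of v], use inV xT vq in force, rule awaits_move)
    have "q \<in> V - insert v {} - insert x {}" using inV xT vq by auto
    then show "V - insert v {} - insert x {} \<noteq> {}" by blast
    fix w assume "w \<in> V - insert v {} - insert x {}"
    then show "forces V (meets_all V N) {v} (insert w (insert x {}))"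
      using prism_Dominator[OF assms T(1)[unfolded vq(1)] vq(2), of "{x}" w] mx(2) by simp
  qed
qed

end

section \<open>Cubic graphs with a triangle-factor\<close>

lemma closed_under_neighbours:
  assumes "graph G" "Digraph_Component.connected G"
    and "u \<in> S" "u \<in> verts G" "\<And>x. x \<in> S \<Longrightarrow> open_nbhd G x \<subseteq> S"
  shows "verts G \<subseteq> S"
proof
  interpret graph G by fact
  fix v assume "v \<in> verts G"
  then have "u \<rightarrow>\<^sup>*\<^bsub>G\<^esub> v"
    using assms(2,4) reachable_mk_symmetric_eq[OF sym_arcs]
    by (simp add: connected_def strongly_connected_def)
  then show "v \<in> S"
    by (induction rule: reachable_induct) (use assms(3,5) in \<open>auto simp: open_nbhd_def\<close>)
qed

text \<open>
  The factor covers all vertices by counting. Two of the three neighbours of \<open>x\<close> are in its triangle,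
  so the third one is determined; if it is \<open>y\<close>, then \<open>x\<close> is a neighbour of \<open>y\<close> outside the triangle
  of \<open>y\<close>, and so \<open>mate\<close> is an involution.
\<close>

lemma cubic_triangle_tiling:
  assumes "graph G" "cubic G" "has_triangle_factor G"
  obtains F mate where "triangle_tiling (verts G) F (open_nbhd G) mate"
proof -
  interpret graph G by fact
  let ?N = "open_nbhd G"
  obtain F where F: "finite F" "card F = card (verts G) div 3" "3 dvd card (verts G)"
    and tri: "\<And>T. T \<in> F \<Longrightarrow> triangle G T" and disj: "pairwise disjnt F"
    using assms(3) by (auto simp: has_triangle_factor_def)
  have card_N: "card (?N x) = 3" if "x \<in> verts G" for x
  proof -
    have "?N x = head G ` out_arcs G x"
      by (auto simp: open_nbhd_def arcs_ends_conv out_arcs_def)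
    moreover have "inj_on (head G) (out_arcs G x)"
      by (rule inj_onI) (auto simp: out_arcs_def arc_to_ends_def intro: no_multi_arcs)
    ultimately show ?thesis
      using assms(2) that by (simp add: card_image cubic_def out_degree_def)
  qed
  have sym: "x \<in> ?N y" if "y \<in> ?N x" for x y
    using that arcs_ends_symmetric[OF sym_arcs] by (simp add: open_nbhd_def)
  have irrefl: "x \<notin> ?N x" for x
    using adj_not_same by (auto simp: open_nbhd_def)
  have N_verts: "?N x \<subseteq> verts G" for x
    by (auto simp: open_nbhd_def)
  have sub: "T \<subseteq> verts G" and card3: "card T = 3" if "T \<in> F" for T
    using tri[OF that] by (auto simp: triangle_def complete_digraph_def)
  have adj: "T - {x} \<subseteq> ?N x" if "T \<in> F" "x \<in> T" for T x
  proof
    fix y assume y: "y \<in> T - {x}"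
    have "arcs_ends (G \<restriction> T) = {(u, v). (u, v) \<in> T \<times> T \<and> u \<noteq> v}"
      using tri[OF that(1)] by (simp add: triangle_def complete_digraph_def)
    then have "(x, y) \<in> arcs_ends (G \<restriction> T)" using y that by auto
    moreover have "arcs_ends (G \<restriction> T) \<subseteq> arcs_ends G"
      by (auto simp: arcs_ends_conv induce_subgraph_def)
    ultimately show "y \<in> ?N x" by (auto simp: open_nbhd_def)
  qed
  have fin: "finite T" if "T \<in> F" for T
    using sub[OF that] finite_verts by (rule finite_subset)
  have cover: "\<Union> F = verts G"
  proof (rule card_subset_eq)
    have "card (\<Union> F) = sum card F"
      using disj fin by (intro card_Union_disjoint)
    also have "\<dots> = 3 * card F" using card3 by simp
    finally show "card (\<Union> F) = card (verts G)" using F by simp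
  qed (use sub in auto)
  have unique: "T = T'" if "T \<in> F" "T' \<in> F" "x \<in> T" "x \<in> T'" for T T' x
    using disj that by (metis disjnt_iff pairwiseD)
  define mate where "mate x = (SOME y. \<exists>T\<in>F. x \<in> T \<and> y \<notin> T \<and> ?N x = insert y (T - {x}))" for x
  have m: "mate x \<notin> T \<and> ?N x = insert (mate x) (T - {x})" if T: "T \<in> F" "x \<in> T" for T x
  proof -
    have x: "x \<in> verts G" using sub T by blast
    have "card (?N x - (T - {x})) = 1"
      using card_N[OF x] card3[OF T(1)] adj[OF T] fin[OF T(1)] T(2)
      by (simp add: card_Diff_subset)
    then obtain y where y: "?N x - (T - {x}) = {y}" by (rule card_1_singletonE)
    have "y \<notin> T \<and> ?N x = insert y (T - {x})" using y irrefl adj[OF T] by blast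
    then have "\<exists>y. \<exists>T\<in>F. x \<in> T \<and> y \<notin> T \<and> ?N x = insert y (T - {x})" using T by blast
    then have "\<exists>T'\<in>F. x \<in> T' \<and> mate x \<notin> T' \<and> ?N x = insert (mate x) (T' - {x})"
      unfolding mate_def by (rule someI_ex)
    then show ?thesis using unique T by metis
  qed
  have "triangle_tiling (verts G) F ?N mate"
  proof
    fix x assume x: "x \<in> verts G"
    then obtain T where T: "T \<in> F" "x \<in> T" using cover by blast
    have mx: "mate x \<in> ?N x" using m[OF T] by blast
    then show mV: "mate x \<in> verts G" using N_verts by blast
    then obtain T' where T': "T' \<in> F" "mate x \<in> T'" using cover by blast
    have "x \<notin> T'" using unique[OF T(1) T'(1)] T T' m[OF T] by blast
    moreover have "x \<in> ?N (mate x)" using sym[OF mx] .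
    ultimately show "mate (mate x) = x" using m[OF T'] by (metis DiffE insertE)
  next
    fix T T' assume "T \<in> F" "T' \<in> F" "T \<noteq> T'"
    then show "T \<inter> T' = {}" using unique by blast
  qed (use cover card3 m in auto)
  then show thesis by (rule that)
qed

theorem theorem1p2:
  fixes G :: "('a, 'b) pre_digraph"
  assumes "graph G"
    and "Digraph_Component.connected G"
    and "cubic G"
    and "card (verts G) \<ge> 6"
    and "has_triangle_factor G"
  shows "(card (verts G) = 6 \<longrightarrow> graph_D G) \<and> (card (verts G) > 6 \<longrightarrow> graph_S G)"
proof -
  let ?V = "verts G" and ?N = "open_nbhd G"
  obtain F mate where "triangle_tiling ?V F ?N mate"
    by (rule cubic_triangle_tiling[OF assms(1,3,5)])
  then interpret triangle_tiling ?V F ?N mate .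
  have card_F: "card ?V = 3 * card F" using card_Union[of F] Union_F by simp
  have conn: "Y = F" if Y: "Y \<subseteq> F" "Y \<noteq> {}" "mate ` \<Union> Y \<subseteq> \<Union> Y" for Y
  proof -
    obtain T where T: "T \<in> Y" using Y by blast
    then have TF: "T \<in> F" using Y by blast
    then obtain u where u: "u \<in> T" using card_tri by fastforce
    have VY: "?V \<subseteq> \<Union> Y"
    proof (rule closed_under_neighbours[OF assms(1,2)])
      show "u \<in> \<Union> Y" using T u by blast
      show "u \<in> ?V" using tri_subset[OF TF] u by blast
      fix x assume "x \<in> \<Union> Y"
      then obtain Q where Q: "Q \<in> Y" "x \<in> Q" by blast
      then have "?N x = insert (mate x) (Q - {x})" using Y(1) by (intro nbhd) auto
      then show "?N x \<subseteq> \<Union> Y" using Y(3) Q by blast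
    qed
    have "F \<subseteq> Y"
    proof
      fix Q assume Q: "Q \<in> F"
      then obtain x where x: "x \<in> Q" using card_tri by fastforce
      then have "x \<in> \<Union> Y" using VY tri_subset[OF Q] by blast
      then obtain Q' where "Q' \<in> Y" "x \<in> Q'" by blast
      then show "Q \<in> Y" using tri_unique[OF Q _ x] Y(1) by blast
    qed
    then show ?thesis using Y(1) by blast
  qed
  show ?thesis
  proof (intro conjI impI)
    assume "card ?V = 6"
    then have "card F = 2" using card_F by simp
    then have "has_winning_strategy G f Dominator" for f
      by (intro Dominator_strategyI) (simp add: Dominator_forces_first Dominator_awaits_second)
    then show "graph_D G" unfolding graph_D_def by blast
  next
    assume "card ?V > 6"
    then have large: "4 \<le> card F" using card_F even_card_V by presburger
    have win: "forces ?V (encloses ?V ?N) {} D" if "u \<in> ?V" "D \<subseteq> {u}" for u D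
      using Staller_forces[OF large conn that] .
    obtain u where u: "u \<in> ?V" using assms(4) by fastforce
    have "forces ?V (encloses ?V ?N) {} {}" using win[OF u] by simp
    moreover have "awaits ?V (encloses ?V ?N) {} {}"
    proof (rule awaits_move)
      show "?V - {} - {} \<noteq> {}" using u by blast
      show "forces ?V (encloses ?V ?N) {} (insert y {})" if "y \<in> ?V - {} - {}" for y
        using win[of y "{y}"] that by simp
    qed
    ultimately have "has_winning_strategy G f Staller" for f
      by (intro Staller_strategyI) simp
    then show "graph_S G" unfolding graph_S_def by blast
  qed
qed

end
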